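(* Suppose $S\subseteq 2^{<\omega_1}$ is a complete coherent Suslin tree and $\mathcal{F}$ is a 2-thin Kurepa family with respect to $S$. Then there is a coloring $c:[S]^2\to 2$ satisfying the following properties. (coh) For all $s<_S t$ in $S$, the set $\{x<_S s: c(x,s)\neq c(x,t)\}$ is finite. (hom) For every $\alpha<\omega_1$, $s\in S\upharpoonright\alpha$, $0<n<\omega$, $\mathscr{A}\in\mathcal{F}\cap[\mathcal{X}_{s,n}]^{\omega_1}$, and every $a\in[S_\alpha]^2$ with $D_{a(0),a(1)}=\{ht(s)\}$, for all but finitely many $b\in\mathscr{A}\cap[S\upharpoonright\alpha]^{<\omega}$ there exists $i<2$ such that if $b(2n-1)<_S a(1)$, then $$c(b(j),a(0))=i\ \text{ and }\ c(b(n+j),a(1))=1-i\quad\text{for all } j<n.$$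
   Context: Trees. A Suslin tree here is an uncountable subset $S\subseteq2^{<\omega_1}$ closed under initial segments, ordered by $<_S$ (proper extension of functions), with no uncountable chain and no uncountable antichain. For $t\in S$, $ht(t)=dom(t)$; $S_\alpha=\{t\in S:ht(t)=\alpha\}$; $S\upharpoonright\alpha=\bigcup_{\beta<\alpha}S_\beta$. For $s,t\in2^{<\omega_1}$, $\Delta(s,t)=\max\{\alpha\le\min\{dom(s),dom(t)\}:s\upharpoonright\alpha=t\upharpoonright\alpha\}$ and $D_{s,t}=\{\xi<\min\{dom(s),dom(t)\}:s(\xi)\ne t(\xi)\}$. $S$ is coherent if $D_{s,t}$ is finite for all $s,t\in S$; a coherent $S$ is complete if for all $s\in S$ and $t\in2^{ht(s)}$, $D_{s,t}$ finite implies $t\in S$. Height order. For $s\ne t$ in $2^{<\omega_1}$, $s<_{ho}t$ iff $ht(s)<ht(t)$, or $ht(s)=ht(t)$ and $s(\Delta(s,t))<t(\Delta(s,t))$. For finite $a\subseteq2^{<\omega_1}$, $a(0),a(1),\dots,a(|a|-1)$ is the $<_{ho}$-increasing enumeration of $a$. For $s\in S$ and $0<n<\omega$, $\mathcal{X}_{s,n}$ is the collection of all $a\in[S]^{2n}$ such that (1) $s\cup\{(ht(s),0)\}<_Sa(0)<_S\dots<_Sa(n-1)$ and $s\cup\{(ht(s),1)\}<_Sa(n)<_S\dots<_Sa(2n-1)$; (2) $ht(a(n-1))<ht(a(n))$ and $D_{a(n-1),a(n)}=\{ht(s)\}$. $\mathscr{A}\subseteq[S]^{<\omega}$ is non-overlapping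 if for $a\ne b$ in $\mathscr{A}$, either $\max\{ht(s):s\in a\}<\min\{ht(t):t\in b\}$ or $\max\{ht(t):t\in b\}<\min\{ht(s):s\in a\}$. For $a\subseteq S$ and $\mathcal{F}'\subseteq P([S]^{<\omega})$ consisting of pairwise disjoint families, $cl(a,\mathcal{F}')$ is the $\subseteq$-least $a^*\subseteq S$ such that $a\subseteq a^*$ and for all $\mathscr{A}\in\mathcal{F}'$, $b\in\mathscr{A}$, either $b\cap a^*=\emptyset$ or $b\subseteq a^*$. $\mathcal{F}$ is a 2-thin Kurepa family with respect to $S$ if $\mathcal{F}\subseteq\bigcup\{[\mathcal{X}_{s,n}]^{\omega_1}:s\in S,0<n<\omega\}$ and: (i) for every $\alpha<\omega_1$, $|\{\mathscr{A}\cap[S\upharpoonright\alpha]^{<\omega}:\mathscr{A}\in\mathcal{F}\}|\le\omega$; (ii) for every $s\in S$, $0<n<\omega$ and every uncountable pairwise disjoint $\mathscr{A}\subseteq\mathcal{X}_{s,n}$ there is $\mathscr{B}\in\mathcal{F}$ with $|\mathscr{A}\cap\mathscr{B}|=\omega_1$; (iii) for every $a\in[S]^{<\omega}$ and $\mathcal{F}'\in[\mathcal{F}]^{<\omega}$, $cl(a,\mathcal{F}')$ is finite; (iv) every $\mathscr{A}\in\mathcal{F}$ is non-overlapping. For a coloring $c:[S]^2\to2$, $c(x,y)$ denotes $c(\{x,y\})$. *)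

theory Defs
  imports Main
    "HOL-Library.Ramsey" "HOL-Library.Equipollence" "HOL-Library.Countable_Set_Type"
    "HOL-Library.Disjoint_Sets"
begin

unbundle cardinal_syntax

(* The countable ordinals, as the field of the least uncountable cardinal (a well-order). *)

typedef omega1 = "Field (cardSuc natLeq)"
proof -
  have "Field (cardSuc natLeq) \<noteq> {}"
    using cardSuc_greater[OF natLeq_Card_order]
      card_of_Field_ordIso[OF cardSuc_Card_order[OF natLeq_Card_order]]
    by (metis Field_natLeq card_of_Field_natLeq UNIV_not_empty card_of_empty3
        ordIso_ordLess_trans ordIso_symmetric ordLess_ordIso_trans ordLess_imp_ordLeq)
  then show ?thesis by blast
qed

lemma well_order_cardSuc_natLeq: "Well_order (cardSuc natLeq)"
  using cardSuc_Card_order natLeq_Card_order card_order_on_def by blast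

instantiation omega1 :: wellorder
begin

definition less_eq_omega1 :: "omega1 \<Rightarrow> omega1 \<Rightarrow> bool" where
  "x \<le> y \<longleftrightarrow> (Rep_omega1 x, Rep_omega1 y) \<in> cardSuc natLeq"

definition less_omega1 :: "omega1 \<Rightarrow> omega1 \<Rightarrow> bool" where
  "(x :: omega1) < y \<longleftrightarrow> x \<le> y \<and> x \<noteq> y"

instance
proof
  fix x y z :: omega1
  have wo: "wo_rel (cardSuc natLeq)"
    using well_order_cardSuc_natLeq by (simp add: wo_rel_def)
  show refl: "x \<le> x"
    using wo_rel.REFL[OF wo] Rep_omega1 by (auto simp: less_eq_omega1_def refl_on_def)
  show trans: "x \<le> z" if "x \<le> y" "y \<le> z"
    using wo_rel.TRANS[OF wo] that unfolding less_eq_omega1_def trans_def by blast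
  show antisym: "x = y" if "x \<le> y" "y \<le> x" for x y :: omega1
    using wo_rel.ANTISYM[OF wo] that unfolding less_eq_omega1_def antisym_def
    by (metis Rep_omega1_inject)
  show "x < y \<longleftrightarrow> x \<le> y \<and> \<not> y \<le> x"
    using antisym refl by (auto simp: less_omega1_def)
  show "x \<le> y \<or> y \<le> x"
    using wo_rel.TOTALS[OF wo] Rep_omega1 by (auto simp: less_eq_omega1_def)
  fix P :: "omega1 \<Rightarrow> bool" and a :: omega1
  assume step: "\<And>x. (\<And>y. y < x \<Longrightarrow> P y) \<Longrightarrow> P x"
  have wf: "wf (inv_image (cardSuc natLeq - Id) Rep_omega1)"
    using wo_rel.WF[OF wo] by (rule wf_inv_image)
  show "P a"
    using wf
  proof (induction a rule: wf_induct_rule)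
    case (less x)
    show ?case
      by (rule step, rule less)
        (auto simp: less_omega1_def less_eq_omega1_def Rep_omega1_inject)
  qed
qed

end

lemma uncountable_omega1: "uncountable (UNIV :: omega1 set)"
proof
  assume "countable (UNIV :: omega1 set)"
  then have "countable (Field (cardSuc natLeq))"
    by (metis countable_image type_definition.Rep_range type_definition_omega1)
  then have "|Field (cardSuc natLeq)| \<le>o natLeq"
    by (simp add: countable_card_le_natLeq)
  then have "cardSuc natLeq \<le>o natLeq"
    using card_of_Field_ordIso[OF cardSuc_Card_order[OF natLeq_Card_order]]
      ordIso_ordLeq_trans ordIso_symmetric by blast
  then show False
    using cardSuc_greater[OF natLeq_Card_order] not_ordLess_ordLeq by blast
qed

lemma countable_lessThan_omega1: "countable {..<x :: omega1}"
proof -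
  let ?r = "cardSuc natLeq"
  have "|underS ?r (Rep_omega1 x)| <o ?r"
    using card_of_underS[OF cardSuc_Card_order[OF natLeq_Card_order]] Rep_omega1 by blast
  then have "|underS ?r (Rep_omega1 x)| \<le>o natLeq"
    using cardSuc_ordLeq_ordLess[OF natLeq_Card_order] card_of_Card_order
    by (metis cardSuc_ordLess_ordLeq natLeq_Card_order)
  then have "countable (underS ?r (Rep_omega1 x))"
    by (simp add: countable_card_le_natLeq)
  moreover have "Rep_omega1 ` {..<x} \<subseteq> underS ?r (Rep_omega1 x)"
    by (auto simp: underS_def less_omega1_def less_eq_omega1_def Rep_omega1_inject)
  ultimately have "countable (Rep_omega1 ` {..<x})"
    using countable_subset by blast
  then show ?thesis
    using countable_image_inj_on Rep_omega1_inject inj_on_def by metis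
qed

unbundle no cardinal_syntax

(* A transfinite binary sequence of length \<alpha> is a partial map with domain the ordinal \<alpha>,
   that is {..<\<alpha>}; the values 0 and 1 are False and True. *)

type_synonym node = "omega1 \<rightharpoonup> bool"

definition bin_seqs :: "node set" where
  "bin_seqs = {t. \<exists>\<alpha>. dom t = {..<\<alpha>}}"

definition ht :: "node \<Rightarrow> omega1" where
  "ht t = (THE \<alpha>. dom t = {..<\<alpha>})"

(* On bin_seqs, inclusion of graphs is end-extension. *)
definition tree_less :: "node \<Rightarrow> node \<Rightarrow> bool" where
  "tree_less s t \<longleftrightarrow> s \<subseteq>\<^sub>m t \<and> s \<noteq> t"

definition level :: "node set \<Rightarrow> omega1 \<Rightarrow> node set" where
  "level S \<alpha> = {t \<in> S. ht t = \<alpha>}"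

definition below_level :: "node set \<Rightarrow> omega1 \<Rightarrow> node set" where
  "below_level S \<alpha> = (\<Union>\<beta>\<in>{..<\<alpha>}. level S \<beta>)"

definition chain_in :: "node set \<Rightarrow> bool" where
  "chain_in C \<longleftrightarrow> (\<forall>s\<in>C. \<forall>t\<in>C. s = t \<or> tree_less s t \<or> tree_less t s)"

definition antichain_in :: "node set \<Rightarrow> bool" where
  "antichain_in A \<longleftrightarrow> (\<forall>s\<in>A. \<forall>t\<in>A. \<not> tree_less s t)"

definition suslin_tree :: "node set \<Rightarrow> bool" where
  "suslin_tree S \<longleftrightarrow>
     S \<subseteq> bin_seqs \<and> uncountable S \<and>
     (\<forall>t\<in>S. \<forall>\<alpha>\<le>ht t. t |` {..<\<alpha>} \<in> S) \<and>
     (\<forall>C\<subseteq>S. chain_in C \<longrightarrow> countable C) \<and>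
     (\<forall>A\<subseteq>S. antichain_in A \<longrightarrow> countable A)"

definition Delta :: "node \<Rightarrow> node \<Rightarrow> omega1" where
  "Delta s t = (GREATEST \<alpha>. \<alpha> \<le> min (ht s) (ht t) \<and> s |` {..<\<alpha>} = t |` {..<\<alpha>})"

definition diff_set :: "node \<Rightarrow> node \<Rightarrow> omega1 set" where
  "diff_set s t = {\<xi>. \<xi> < min (ht s) (ht t) \<and> s \<xi> \<noteq> t \<xi>}"

definition coherent :: "node set \<Rightarrow> bool" where
  "coherent S \<longleftrightarrow> (\<forall>s\<in>S. \<forall>t\<in>S. finite (diff_set s t))"

definition complete_coherent :: "node set \<Rightarrow> bool" where
  "complete_coherent S \<longleftrightarrow>
     coherent S \<and>
     (\<forall>s\<in>S. \<forall>t\<in>bin_seqs. ht t = ht s \<longrightarrow> finite (diff_set s t) \<longrightarrow> t \<in> S)"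

definition ho_less :: "node \<Rightarrow> node \<Rightarrow> bool" where
  "ho_less s t \<longleftrightarrow>
     s \<noteq> t \<and>
     (ht s < ht t \<or> ht s = ht t \<and> the (s (Delta s t)) < the (t (Delta s t)))"

definition ho_enum :: "node set \<Rightarrow> nat \<Rightarrow> node" where
  "ho_enum a i = (THE xs. sorted_wrt ho_less xs \<and> set xs = a) ! i"

definition XX :: "node set \<Rightarrow> node \<Rightarrow> nat \<Rightarrow> node set set" where
  "XX S s n = {a \<in> nsets S (2 * n).
     tree_less (s(ht s \<mapsto> False)) (ho_enum a 0) \<and>
     (\<forall>i. Suc i < n \<longrightarrow> tree_less (ho_enum a i) (ho_enum a (Suc i))) \<and>
     tree_less (s(ht s \<mapsto> True)) (ho_enum a n) \<and>
     (\<forall>i. Suc i < n \<longrightarrow> tree_less (ho_enum a (n + i)) (ho_enum a (n + Suc i))) \<and>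
     ht (ho_enum a (n - 1)) < ht (ho_enum a n) \<and>
     diff_set (ho_enum a (n - 1)) (ho_enum a n) = {ht s}}"

definition subsets_omega1 :: "'a set \<Rightarrow> 'a set set" where
  "subsets_omega1 X = {Y. Y \<subseteq> X \<and> Y \<approx> (UNIV :: omega1 set)}"

definition non_overlapping :: "node set set \<Rightarrow> bool" where
  "non_overlapping A \<longleftrightarrow>
     (\<forall>a\<in>A. \<forall>b\<in>A. a \<noteq> b \<longrightarrow>
        Max (ht ` a) < Min (ht ` b) \<or> Max (ht ` b) < Min (ht ` a))"

(* For a \<subseteq> S and families of subsets of S the least set exists: the closed sets between a and S
   include S and are stable under intersection. *)
definition cl :: "node set \<Rightarrow> node set \<Rightarrow> node set set set \<Rightarrow> node set" where
  "cl S a F' = (LEAST a'. a' \<subseteq> S \<and> a \<subseteq> a' \<and>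
     (\<forall>A\<in>F'. \<forall>b\<in>A. b \<inter> a' = {} \<or> b \<subseteq> a'))"

definition thin_kurepa_family :: "node set \<Rightarrow> node set set set \<Rightarrow> bool" where
  "thin_kurepa_family S F \<longleftrightarrow>
     F \<subseteq> (\<Union>s\<in>S. \<Union>n\<in>{0<..}. subsets_omega1 (XX S s n)) \<and>
     (\<forall>\<alpha>. countable {A \<inter> Fpow (below_level S \<alpha>) |A. A \<in> F}) \<and>
     (\<forall>s\<in>S. \<forall>n>0. \<forall>A\<subseteq>XX S s n. uncountable A \<longrightarrow> disjoint A \<longrightarrow>
        (\<exists>B\<in>F. A \<inter> B \<approx> (UNIV :: omega1 set))) \<and>
     (\<forall>a\<in>Fpow S. \<forall>F'\<in>Fpow F. finite (cl S a F')) \<and>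
     (\<forall>A\<in>F. non_overlapping A)"

end

theory Submission
  imports Defs
begin

text \<open>The coloring is built by recursion on the height \<open>\<alpha>\<close> of the upper node. At a successor level
  the coloring of the predecessor level is copied; since families are non-overlapping, only one
  new \<open>b\<close> can fail. At a limit \<open>\<alpha>\<close>, fix a cofinal sequence \<open>\<alpha>\<^sub>k\<close>, an enumeration of \<open>S\<^sub>\<alpha>\<close>, one of
  the countably many traces of members of \<open>F\<close>, and a finite set \<open>E\<^sub>k\<close>, closed under the first \<open>k\<close>
  traces, that contains all of their elements which straddle \<open>\<alpha>\<^sub>k\<close> or on which the coloring
  of level \<open>\<alpha>\<^sub>k\<close> fails for one of the first \<open>k\<close> nodes. A node \<open>x\<close> is colored at the first \<open>k\<close> where
  it lies in \<open>S\<restriction>\<alpha>\<^sub>k \<union> E\<^sub>k\<close>: as at level \<open>\<alpha>\<^sub>k\<close> if \<open>x \<notin> E\<^sub>k\<close>, and otherwise \<open>c(x, t)\<close> is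
  the parity of \<open>|D\<^sub>t\<^sub>,\<^sub>e|\<close> for a fixed \<open>e \<in> S\<^sub>\<alpha>\<close>. This parity does not depend on \<open>x\<close> and differs
  for two nodes that differ at one place, so it never fails.\<close>

lemma least_witness:
  fixes P :: "'a :: wellorder \<Rightarrow> bool"
  assumes "\<exists>x. P x"
  obtains x where "P x" and "\<And>y. y < x \<Longrightarrow> \<not> P y"
  using assms exists_least_iff[of P] by auto

section \<open>Enumeration in the height order\<close>

text \<open>Were the heads different, each would occur in the tail of the other list and the two
  would precede each other. Asymmetry also excludes repetitions, so removing the common head leaves
  tails with equal sets.\<close>

lemma sorted_wrt_set_unique:
  assumes "sorted_wrt P xs" and "sorted_wrt P ys" and "set xs = set ys"
    and "asymp_on (set xs) P"
  shows "xs = ys"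
  using assms
proof (induction xs arbitrary: ys)
  case Nil
  then show ?case by simp
next
  case (Cons x xs)
  then obtain y ys' where ys: "ys = y # ys'"
    by (cases ys) auto
  have asym: "\<not> (P u v \<and> P v u)" if "u \<in> set (x # xs)" "v \<in> set (x # xs)" for u v
    using Cons.prems(4) that unfolding asymp_on_def by blast
  have P_xs: "\<forall>z\<in>set xs. P x z" and P_ys: "\<forall>z\<in>set ys'. P y z"
    using Cons.prems ys by auto
  have sets: "insert x (set xs) = insert y (set ys')"
    using Cons.prems ys by auto
  have "x = y"
  proof (rule ccontr)
    assume "x \<noteq> y"
    then have "y \<in> set xs" "x \<in> set ys'"
      using sets by auto
    then show False
      using P_xs P_ys asym[of x y] by auto
  qed
  moreover have "x \<notin> set xs" "y \<notin> set ys'"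
    using P_xs P_ys asym[of x x] \<open>x = y\<close> by auto
  ultimately have "set xs = set ys'"
    using sets by auto
  then have "xs = ys'"
    using Cons.prems ys by (intro Cons.IH) (auto simp: asymp_on_def)
  with \<open>x = y\<close> ys show ?case by simp
qed

text \<open>A new element splits a sorted list into the elements that precede it and the rest, which
  follow it by totality. The length clause later yields distinctness of the list.\<close>

lemma sorted_wrt_set_exists:
  assumes "finite a" and "transp_on a P" and "totalp_on a P"
  shows "\<exists>xs. sorted_wrt P xs \<and> set xs = a \<and> length xs = card a"
  using assms
proof (induction a rule: finite_induct)
  case empty
  then show ?case by simp
next
  case (insert x a)
  then obtain xs where xs: "sorted_wrt P xs" "set xs = a" "length xs = card a"
    by (metis subset_insertI totalp_on_subset transp_on_subset)
  have tot: "P x y \<or> P y x" if "y \<in> a" for y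
    using insert.prems(2) insert.hyps(2) that unfolding totalp_on_def by (metis insertCI)
  have trans: "P u w" if "P u v" "P v w" "u \<in> insert x a" "v \<in> insert x a" "w \<in> insert x a"
    for u v w
    using insert.prems(1) that unfolding transp_on_def by blast
  let ?ys = "filter (\<lambda>y. P y x) xs @ x # filter (\<lambda>y. \<not> P y x) xs"
  have "sorted_wrt P ?ys"
    using xs tot trans by (auto simp: sorted_wrt_append sorted_wrt_filter)
  moreover have "set ?ys = insert x a"
    using xs by auto
  moreover have "length ?ys = card (insert x a)"
    using xs insert sum_length_filter_compl[of "\<lambda>y. P y x" xs] by simp
  ultimately show ?case by blast
qed

section \<open>Heights, and the height order as a strict linear order on sequences\<close>

lemma dom_bin_seqs:
  assumes "t \<in> bin_seqs"
  shows "dom t = {..<ht t}"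
proof -
  obtain \<alpha> where "dom t = {..<\<alpha>}"
    using assms by (auto simp: bin_seqs_def)
  then show ?thesis
    unfolding ht_def by (metis (mono_tags, lifting) lessThan_eq_iff theI)
qed

lemma ht_eqI: "dom t = {..<\<alpha>} \<Longrightarrow> ht t = \<alpha>"
  using dom_bin_seqs[of t] by (auto simp: bin_seqs_def)

lemma bin_seqs_eq_iff:
  assumes "s \<in> bin_seqs" "t \<in> bin_seqs" "ht s = ht t"
  shows "s = t \<longleftrightarrow> (\<forall>\<xi><ht s. s \<xi> = t \<xi>)"
proof -
  have "s \<xi> = t \<xi>" if "\<not> \<xi> < ht s" for \<xi>
    using dom_bin_seqs[OF assms(1)] dom_bin_seqs[OF assms(2)] that assms(3)
    by (metis domIff lessThan_iff)
  then show ?thesis by (auto simp: fun_eq_iff)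
qed

text \<open>For distinct sequences of one height, the greatest length of agreement is the first
  place of disagreement. So the order is lexicographic there, and asymmetry, transitivity and
  totality come down to comparing first places of disagreement.\<close>

lemma ho_less_same_height_iff:
  assumes "s \<in> bin_seqs" "t \<in> bin_seqs" "ht s = ht t"
  shows "ho_less s t \<longleftrightarrow>
    (\<exists>\<delta><ht s. (\<forall>\<xi><\<delta>. s \<xi> = t \<xi>) \<and> s \<delta> = Some False \<and> t \<delta> = Some True)"
proof -
  have Delta: "Delta s t = \<delta>" if "\<delta> < ht s" "\<forall>\<xi><\<delta>. s \<xi> = t \<xi>" "s \<delta> \<noteq> t \<delta>" for \<delta>
    unfolding Delta_def
  proof (rule Greatest_equality)
    show "\<delta> \<le> min (ht s) (ht t) \<and> s |` {..<\<delta>} = t |` {..<\<delta>}"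
      using that assms by (auto simp: restrict_map_def fun_eq_iff)
    fix \<epsilon>
    assume "\<epsilon> \<le> min (ht s) (ht t) \<and> s |` {..<\<epsilon>} = t |` {..<\<epsilon>}"
    then have "\<not> \<delta> < \<epsilon>"
      using that(3) by (metis lessThan_iff restrict_in)
    then show "\<epsilon> \<le> \<delta>" by simp
  qed
  have "ho_less s t" if "\<delta> < ht s" "\<forall>\<xi><\<delta>. s \<xi> = t \<xi>" "s \<delta> = Some False" "t \<delta> = Some True" for \<delta>
    using Delta[of \<delta>] that assms(3) unfolding ho_less_def by auto
  moreover have "\<exists>\<delta><ht s. (\<forall>\<xi><\<delta>. s \<xi> = t \<xi>) \<and> s \<delta> = Some False \<and> t \<delta> = Some True"
    if ho: "ho_less s t"
  proof -
    have "\<exists>\<delta>. \<delta> < ht s \<and> s \<delta> \<noteq> t \<delta>"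
      using ho bin_seqs_eq_iff[OF assms] by (auto simp: ho_less_def)
    then obtain \<delta> where \<delta>': "\<delta> < ht s \<and> s \<delta> \<noteq> t \<delta>"
      and least: "\<And>\<xi>. \<xi> < \<delta> \<Longrightarrow> \<not> (\<xi> < ht s \<and> s \<xi> \<noteq> t \<xi>)"
      by (rule least_witness) blast
    then have \<delta>: "\<delta> < ht s" "s \<delta> \<noteq> t \<delta>"
      by auto
    have agree: "\<forall>\<xi><\<delta>. s \<xi> = t \<xi>"
      using least \<delta> by (meson less_trans)
    have "the (s \<delta>) < the (t \<delta>)"
      using Delta[OF \<delta>(1) agree \<delta>(2)] ho assms(3) by (auto simp: ho_less_def)
    moreover have "\<delta> \<in> dom s" "\<delta> \<in> dom t"
      using \<delta> assms dom_bin_seqs by auto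
    ultimately show ?thesis
      using \<delta> agree by (intro exI[of _ \<delta>]) auto
  qed
  ultimately show ?thesis by blast
qed

lemma asymp_on_ho_less: "asymp_on bin_seqs ho_less"
proof (rule asymp_onI)
  fix s t
  assume st: "s \<in> bin_seqs" "t \<in> bin_seqs" "ho_less s t"
  show "\<not> ho_less t s"
  proof
    assume ts: "ho_less t s"
    then have ht: "ht s = ht t"
      using st by (auto simp: ho_less_def)
    obtain \<delta> \<epsilon> where "\<forall>\<xi><\<delta>. s \<xi> = t \<xi>" "s \<delta> = Some False" "t \<delta> = Some True"
      and "\<forall>\<xi><\<epsilon>. t \<xi> = s \<xi>" "t \<epsilon> = Some False" "s \<epsilon> = Some True"
      using st ts ho_less_same_height_iff[of s t] ho_less_same_height_iff[of t s] ht by auto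
    then show False
      by (cases \<delta> \<epsilon> rule: linorder_cases) auto
  qed
qed

lemma transp_on_ho_less: "transp_on bin_seqs ho_less"
proof (rule transp_onI)
  fix s t u
  assume stu: "s \<in> bin_seqs" "t \<in> bin_seqs" "u \<in> bin_seqs" "ho_less s t" "ho_less t u"
  then have le: "ht s \<le> ht t" "ht t \<le> ht u"
    by (auto simp: ho_less_def)
  show "ho_less s u"
  proof (cases "ht s = ht u")
    case False
    then show ?thesis
      using le by (auto simp: ho_less_def)
  next
    case True
    then have ht: "ht s = ht t" "ht t = ht u"
      using le by auto
    obtain \<delta> \<epsilon> where \<delta>: "\<delta> < ht s" "\<forall>\<xi><\<delta>. s \<xi> = t \<xi>" "s \<delta> = Some False" "t \<delta> = Some True"
      and \<epsilon>: "\<epsilon> < ht t" "\<forall>\<xi><\<epsilon>. t \<xi> = u \<xi>" "t \<epsilon> = Some False" "u \<epsilon> = Some True"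
      using stu ho_less_same_height_iff[of s t] ho_less_same_height_iff[of t u] ht by auto
    have "\<exists>\<delta><ht s. (\<forall>\<xi><\<delta>. s \<xi> = u \<xi>) \<and> s \<delta> = Some False \<and> u \<delta> = Some True"
    proof (cases \<delta> \<epsilon> rule: linorder_cases)
      case less
      then show ?thesis
        using \<delta> \<epsilon> by (intro exI[of _ \<delta>]) auto
    next
      case equal
      then show ?thesis using \<delta> \<epsilon> by auto
    next
      case greater
      then show ?thesis
        using \<delta> \<epsilon> ht by (intro exI[of _ \<epsilon>]) auto
    qed
    then show ?thesis
      using ho_less_same_height_iff[of s u] stu True by auto
  qed
qed

lemma totalp_on_ho_less: "totalp_on bin_seqs ho_less"
proof (rule totalp_onI)
  fix s t
  assume st: "s \<in> bin_seqs" "t \<in> bin_seqs" "s \<noteq> t"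
  show "ho_less s t \<or> ho_less t s"
  proof (cases "ht s = ht t")
    case False
    then show ?thesis
      using st by (auto simp: ho_less_def)
  next
    case True
    then have "\<exists>\<delta>. \<delta> < ht s \<and> s \<delta> \<noteq> t \<delta>"
      using bin_seqs_eq_iff st by blast
    then obtain \<delta> where \<delta>': "\<delta> < ht s \<and> s \<delta> \<noteq> t \<delta>"
      and least: "\<And>\<xi>. \<xi> < \<delta> \<Longrightarrow> \<not> (\<xi> < ht s \<and> s \<xi> \<noteq> t \<xi>)"
      by (rule least_witness) blast
    then have \<delta>: "\<delta> < ht s" "s \<delta> \<noteq> t \<delta>"
      by auto
    have agree: "\<forall>\<xi><\<delta>. s \<xi> = t \<xi>"
      using least \<delta> by (meson less_trans)
    have "\<delta> \<in> dom s" "\<delta> \<in> dom t"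
      using \<delta> st True dom_bin_seqs by auto
    then have "s \<delta> = Some False \<and> t \<delta> = Some True \<or> s \<delta> = Some True \<and> t \<delta> = Some False"
      using \<delta> by auto
    then show ?thesis
      using ho_less_same_height_iff[of s t] ho_less_same_height_iff[of t s] st True \<delta> agree
      by (metis (full_types))
  qed
qed

text \<open>Existence and uniqueness of the sorted list make the description in
  \<open>ho_enum\<close> denote it; that list is distinct because its length is the cardinality of
  \<open>a\<close>.\<close>

lemma bij_betw_ho_enum:
  assumes "finite a" "a \<subseteq> bin_seqs"
  shows "bij_betw (ho_enum a) {..<card a} a"
proof -
  obtain xs where xs: "sorted_wrt ho_less xs" "set xs = a" "length xs = card a"
    using sorted_wrt_set_exists[OF assms(1)]
      transp_on_subset[OF transp_on_ho_less assms(2)]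
      totalp_on_subset[OF totalp_on_ho_less assms(2)] by blast
  have asym: "asymp_on a ho_less"
    using asymp_on_subset[OF asymp_on_ho_less assms(2)] .
  have "(THE ys. sorted_wrt ho_less ys \<and> set ys = a) = xs"
  proof (rule the_equality)
    show "sorted_wrt ho_less xs \<and> set xs = a"
      using xs by simp
    fix ys
    assume "sorted_wrt ho_less ys \<and> set ys = a"
    then show "ys = xs"
      by (intro sorted_wrt_set_unique[of ho_less]) (simp_all add: xs asym)
  qed
  then have "ho_enum a = (!) xs"
    by (intro ext) (simp only: ho_enum_def)
  moreover have "distinct xs"
    using xs by (simp add: card_distinct)
  ultimately show ?thesis
    using xs by (simp add: bij_betw_nth)
qed

lemma ho_enum_mem:
  assumes "finite a" "a \<subseteq> bin_seqs" "i < card a"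
  shows "ho_enum a i \<in> a"
  using bij_betwE[OF bij_betw_ho_enum[OF assms(1,2)]] assms(3) by auto

section \<open>Gluing colorings at a limit stage\<close>

definition opposite_on :: "'a set \<Rightarrow> 'a set \<Rightarrow> ('a \<Rightarrow> bool) \<Rightarrow> ('a \<Rightarrow> bool) \<Rightarrow> bool" where
  "opposite_on B C p q \<longleftrightarrow> (\<exists>i. (\<forall>x\<in>B. p x = i) \<and> (\<forall>x\<in>C. q x = (\<not> i)))"

lemma opposite_on_cong:
  assumes "\<And>x. x \<in> B \<Longrightarrow> p x = p' x" "\<And>x. x \<in> C \<Longrightarrow> q x = q' x"
  shows "opposite_on B C p q = opposite_on B C p' q'"
  using assms by (simp add: opposite_on_def)

text \<open>The limit step freed from trees. \<open>X k\<close> stands for the nodes below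
  \<open>\<alpha>\<^sub>k\<close>, \<open>h k\<close> for the coloring of level
  \<open>\<alpha>\<^sub>k\<close> pulled back to level \<alpha>, \<open>t\<close> and
  \<open>T\<close> for enumerations of level \<alpha> and of the traces, \<open>R l u v\<close> for
  \<open>u\<close> and \<open>v\<close> differing only at the root of a family with trace
  \<open>T l\<close>, and \<open>p\<close> for the parity.\<close>

lemma limit_coloring:
  fixes X :: "nat \<Rightarrow> 'x set" and h :: "nat \<Rightarrow> 't \<Rightarrow> 'x \<Rightarrow> bool"
    and T :: "nat \<Rightarrow> 'x set set" and t :: "nat \<Rightarrow> 't"
    and lo hi :: "'x set \<Rightarrow> 'x set" and R :: "nat \<Rightarrow> 't \<Rightarrow> 't \<Rightarrow> bool"
    and p :: "'t \<Rightarrow> bool"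
  assumes mono: "\<And>j k. j \<le> k \<Longrightarrow> X j \<subseteq> X k"
    and coh: "\<And>j k u. j \<le> k \<Longrightarrow> u \<in> range t \<Longrightarrow> finite {x \<in> X j. h j u x \<noteq> h k u x}"
    and T: "\<And>l b. b \<in> T l \<Longrightarrow> finite b \<and> b \<noteq> {} \<and> b \<subseteq> (\<Union>k. X k)"
    and straddle: "\<And>l k. finite {b \<in> T l. b \<inter> X k \<noteq> {} \<and> \<not> b \<subseteq> X k}"
    and closure: "\<And>m E. finite E \<Longrightarrow> E \<subseteq> (\<Union>k. X k) \<Longrightarrow>
      \<exists>E'. finite E' \<and> E \<subseteq> E' \<and> (\<forall>l<m. \<forall>b\<in>T l. b \<inter> E' = {} \<or> b \<subseteq> E')"
    and sub: "\<And>l b. b \<in> T l \<Longrightarrow> lo b \<subseteq> b \<and> hi b \<subseteq> b"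
    and R: "\<And>l u v. R l u v \<Longrightarrow> u \<in> range t \<and> v \<in> range t \<and> p u \<noteq> p v"
    and bad: "\<And>l u v k. R l u v \<Longrightarrow>
      finite {b \<in> T l. b \<subseteq> X k \<and> \<not> opposite_on (lo b) (hi b) (h k u) (h k v)}"
  obtains r :: "'t \<Rightarrow> 'x \<Rightarrow> bool"
  where "\<And>k u. u \<in> range t \<Longrightarrow> finite {x \<in> X k. r u x \<noteq> h k u x}"
    and "\<And>l u v. R l u v \<Longrightarrow>
      finite {b \<in> T l. \<not> opposite_on (lo b) (hi b) (r u) (r v)}"
proof -
  \<comment> \<open>Restricting stage \<open>k\<close> to the pairs among the first \<open>k\<close>
    nodes keeps each set finite, while every fixed pair is taken into account at all late
    stages.\<close>
  define Bad where "Bad k l = {b \<in> T l. b \<inter> X k \<noteq> {} \<and> \<not> b \<subseteq> X k} \<union>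
    (\<Union>i<k. \<Union>j<k. {b \<in> T l. R l (t i) (t j) \<and> b \<subseteq> X k \<and>
      \<not> opposite_on (lo b) (hi b) (h k (t i)) (h k (t j))})" for k l
  have fin_Bad: "finite (Bad k l)" for k l
  proof -
    have "finite {b \<in> T l. R l (t i) (t j) \<and> b \<subseteq> X k \<and>
        \<not> opposite_on (lo b) (hi b) (h k (t i)) (h k (t j))}" for i j
      using bad[of l "t i" "t j" k] by (cases "R l (t i) (t j)") auto
    then show ?thesis
      using straddle unfolding Bad_def by blast
  qed
  have Bad_T: "Bad k l \<subseteq> T l" for k l
    by (auto simp: Bad_def)
  have "\<forall>k. \<exists>E. finite E \<and> (\<Union>l<k. \<Union>(Bad k l)) \<subseteq> E \<and>
      (\<forall>l<k. \<forall>b\<in>T l. b \<inter> E = {} \<or> b \<subseteq> E)"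
  proof
    fix k
    have "finite (\<Union>(Bad k l))" for l
    proof (rule finite_Union[OF fin_Bad])
      show "finite b" if "b \<in> Bad k l" for b
        using T[of b l] Bad_T[of k l] that by auto
    qed
    then have "finite (\<Union>l<k. \<Union>(Bad k l))"
      by (intro finite_UN_I finite_lessThan)
    moreover have "b \<subseteq> (\<Union>k. X k)" if "b \<in> Bad k l" for b l
      using T[of b l] Bad_T[of k l] that by (meson subsetD)
    then have "(\<Union>l<k. \<Union>(Bad k l)) \<subseteq> (\<Union>k. X k)"
      by (intro UN_least Union_least)
    ultimately show "\<exists>E. finite E \<and> (\<Union>l<k. \<Union>(Bad k l)) \<subseteq> E \<and>
        (\<forall>l<k. \<forall>b\<in>T l. b \<inter> E = {} \<or> b \<subseteq> E)"
      by (rule closure)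
  qed
  from choice[OF this] obtain E where E: "\<forall>k. finite (E k) \<and>
      (\<Union>l<k. \<Union>(Bad k l)) \<subseteq> E k \<and> (\<forall>l<k. \<forall>b\<in>T l. b \<inter> E k = {} \<or> b \<subseteq> E k)"
    by (rule exE)
  have fin_E: "finite (E k)" for k
    using E[rule_format, of k] by blast
  have Bad_E: "b \<subseteq> E k" if "l < k" "b \<in> Bad k l" for k l b
    using E[rule_format, of k] that by blast
  have closed_E: "b \<inter> E k = {} \<or> b \<subseteq> E k" if "l < k" "b \<in> T l" for k l b
    using E[rule_format, of k] that by blast

  \<comment> \<open>Members of \<open>T l\<close> that meet \<open>G\<close> are subsets of one
    finite closed set. Hence a finite exceptional set of points spoils only finitely many
    members.\<close>
  have meet_finite: "finite {b \<in> T l. b \<inter> G \<noteq> {}}" if "finite G" for l G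
  proof -
    have "\<exists>E'. finite E' \<and> G \<inter> (\<Union>k. X k) \<subseteq> E' \<and>
        (\<forall>l'<Suc l. \<forall>b\<in>T l'. b \<inter> E' = {} \<or> b \<subseteq> E')"
      using \<open>finite G\<close> by (intro closure) auto
    then obtain E' where E': "finite E'" "G \<inter> (\<Union>k. X k) \<subseteq> E'"
        "\<forall>b\<in>T l. b \<inter> E' = {} \<or> b \<subseteq> E'"
      by (metis lessI)
    have "b \<subseteq> E'" if "b \<in> T l" "b \<inter> G \<noteq> {}" for b
    proof -
      have "b \<subseteq> (\<Union>k. X k)"
        using T[OF that(1)] by simp
      then have "b \<inter> E' \<noteq> {}"
        using that(2) E'(2) by blast
      then show ?thesis
        using E'(3) that(1) by auto
    qed
    then have "{b \<in> T l. b \<inter> G \<noteq> {}} \<subseteq> Pow E'"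
      by auto
    then show ?thesis
      using E'(1) finite_subset by auto
  qed

  define N where "N k = X k \<union> E k" for k
  \<comment> \<open>This is unspecified for \<open>x\<close> outside every \<open>N k\<close>; such
    points lie in no \<open>X k\<close> and in no member of any \<open>T l\<close>.\<close>
  define least where "least x = (LEAST k. x \<in> N k)" for x
  define r where "r u x = (if x \<in> E (least x) then p u else h (least x) u x)" for u x
  have least_eqI: "least x = k" if "x \<in> N k" "\<And>j. j < k \<Longrightarrow> x \<notin> N j" for x k
    unfolding least_def using that by (intro Least_equality) (auto simp: not_less[symmetric])
  have r_coh: "finite {x \<in> X k. r u x \<noteq> h k u x}" if u: "u \<in> range t" for k u
  proof (rule finite_subset)
    \<comment> \<open>A point of \<open>X k\<close> is reached by stage \<open>k\<close>. Either it
      got the value of \<open>p\<close>, and lies in one of finitely many finite sets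
      \<open>E j\<close>, or it was colored as at an earlier or equal stage \<open>j\<close>, which
      disagrees with stage \<open>k\<close> only finitely often.\<close>
    show "{x \<in> X k. r u x \<noteq> h k u x} \<subseteq>
        (\<Union>j\<le>k. E j) \<union> (\<Union>j\<le>k. {x \<in> X j. h j u x \<noteq> h k u x})"
    proof
      fix x
      assume x: "x \<in> {x \<in> X k. r u x \<noteq> h k u x}"
      then have "x \<in> N k" by (simp add: N_def)
      then have "least x \<le> k" "x \<in> N (least x)"
        unfolding least_def by (auto intro: Least_le LeastI)
      then show "x \<in> (\<Union>j\<le>k. E j) \<union> (\<Union>j\<le>k. {x \<in> X j. h j u x \<noteq> h k u x})"
        using x by (auto simp: r_def N_def split: if_splits)
    qed
    show "finite ((\<Union>j\<le>k. E j) \<union> (\<Union>j\<le>k. {x \<in> X j. h j u x \<noteq> h k u x}))"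
      using fin_E coh u by auto
  qed
  have r_hom: "finite {b \<in> T l. \<not> opposite_on (lo b) (hi b) (r u) (r v)}" if Rl: "R l u v" for l u v
  proof -
    obtain i j where ij: "u = t i" "v = t j" and puv: "p u \<noteq> p v"
      using R[OF Rl] by auto
    \<comment> \<open>For every stage \<open>k\<close> from \<open>m\<close> on, the indices
      \<open>l\<close>, \<open>i\<close> and \<open>j\<close> are below \<open>k\<close>, so
      \<open>E k\<close> takes care of this trace and this pair.\<close>
    define m where "m = Suc (max l (max i j))"
    \<comment> \<open>Finitely many points to avoid: those captured by stage \<open>m\<close>, and
      those of \<open>X m\<close> where \<open>r\<close> departs from \<open>h m\<close>. A member
      of \<open>T l\<close> disjoint from \<open>G\<close> is shown not to fail.\<close>
    define G where "G = (\<Union>k\<le>m. E k) \<union> {x \<in> X m. r u x \<noteq> h m u x} \<union> {x \<in> X m. r v x \<noteq> h m v x}"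
    have "finite G"
      unfolding G_def using fin_E r_coh R[OF Rl] by auto
    have not_Bad: "(b \<inter> X k = {} \<or> b \<subseteq> X k) \<and>
        (b \<subseteq> X k \<longrightarrow> opposite_on (lo b) (hi b) (h k u) (h k v))"
      if "b \<in> T l" "m \<le> k" "b \<inter> E k = {}" for b k
    proof -
      have "i < k" "j < k" "l < k"
        using that(2) by (auto simp: m_def)
      have "b \<notin> Bad k l"
        using Bad_E[OF \<open>l < k\<close>, of b] T[OF that(1)] that(3) by auto
      then show ?thesis
        using \<open>i < k\<close> \<open>j < k\<close> that(1) Rl ij unfolding Bad_def by blast
    qed
    have "opposite_on (lo b) (hi b) (r u) (r v)" if b: "b \<in> T l" and disj: "b \<inter> G = {}" for b
    proof (cases "b \<inter> X m = {}")
      case False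
      have "b \<inter> E m = {}"
        using disj by (auto simp: G_def)
      then have "b \<subseteq> X m" "opposite_on (lo b) (hi b) (h m u) (h m v)"
        using not_Bad[OF b order_refl] False by auto
      moreover have "r u x = h m u x" "r v x = h m v x" if "x \<in> b" for x
        using that disj \<open>b \<subseteq> X m\<close> by (auto simp: G_def)
      ultimately show ?thesis
        using opposite_on_cong[of "lo b" "r u" "h m u" "hi b" "r v" "h m v"] sub[OF b] by blast
    next
      case True
      \<comment> \<open>Now \<open>b\<close> is first reached after stage \<open>m\<close>. At that
        stage it is reached as a whole: if it meets \<open>E k\<close> it lies inside by closure,
        and otherwise it is not bad and lies in \<open>X k\<close>. So all of \<open>b\<close> is
        colored by a single rule.\<close>
      have none: "b \<inter> N k = {}" if "k \<le> m" for k
        using that True disj mono[OF that] by (auto simp: N_def G_def)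
      obtain x where "x \<in> b" "x \<in> (\<Union>k. X k)"
        using T[OF b] by (metis ex_in_conv subsetD)
      then have "\<exists>k. b \<inter> N k \<noteq> {}"
        unfolding N_def by blast
      then obtain k where k: "b \<inter> N k \<noteq> {}" and before: "\<And>j. j < k \<Longrightarrow> \<not> b \<inter> N j \<noteq> {}"
        by (rule least_witness) blast
      have "m < k"
        using none k by (meson not_le)
      then have "l < k" by (simp add: m_def)
      have least: "least x = k" if "x \<in> b" "x \<in> N k" for x
        using least_eqI[of x k] that before by blast
      show ?thesis
      proof (cases "b \<inter> E k = {}")
        case True
        then have "b \<subseteq> X k" and opp: "opposite_on (lo b) (hi b) (h k u) (h k v)"
          using not_Bad[OF b, of k] k \<open>m < k\<close> by (auto simp: N_def)
        then have "r w x = h k w x" if "x \<in> b" for w x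
          using that least[of x] True by (auto simp: r_def N_def)
        then show ?thesis
          using opp sub[OF b] opposite_on_cong[of "lo b" "r u" "h k u" "hi b" "r v" "h k v"] by blast
      next
        case False
        then have "b \<subseteq> E k"
          using closed_E[OF \<open>l < k\<close> b] by auto
        \<comment> \<open>On \<open>b\<close> both colorings are constant, with the opposite values
          \<open>p u\<close> and \<open>p v\<close>.\<close>
        then have "r w x = p w" if "x \<in> b" for w x
          using that least[of x] by (auto simp: r_def N_def)
        then show ?thesis
          using puv sub[OF b] unfolding opposite_on_def by (intro exI[of _ "p u"]) auto
      qed
    qed
    then have "{b \<in> T l. \<not> opposite_on (lo b) (hi b) (r u) (r v)} \<subseteq> {b \<in> T l. b \<inter> G \<noteq> {}}"
      by blast
    then show ?thesis
      using meet_finite[OF \<open>finite G\<close>] finite_subset by blast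
  qed
  show thesis
    using r_coh r_hom by (rule that)
qed


section \<open>Levels of the tree\<close>

lemma dom_restrict_bin_seqs:
  assumes "t \<in> bin_seqs" "\<beta> \<le> ht t"
  shows "dom (t |` {..<\<beta>}) = {..<\<beta>}"
  using dom_bin_seqs[OF assms(1)] assms(2) by auto

lemma ht_restrict:
  assumes "t \<in> bin_seqs" "\<beta> \<le> ht t"
  shows "ht (t |` {..<\<beta>}) = \<beta>"
  using dom_restrict_bin_seqs[OF assms] by (rule ht_eqI)

lemma tree_less_bin_seqs:
  assumes "s \<in> bin_seqs" "t \<in> bin_seqs" "tree_less s t"
  shows "ht s < ht t" and "t |` {..<ht s} = s"
proof -
  have le: "s \<subseteq>\<^sub>m t" and ne: "s \<noteq> t"
    using assms(3) by (auto simp: tree_less_def)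
  show eq: "t |` {..<ht s} = s"
  proof
    fix \<xi>
    show "(t |` {..<ht s}) \<xi> = s \<xi>"
    proof (cases "\<xi> \<in> dom s")
      case True
      then show ?thesis
        using le dom_bin_seqs[OF assms(1)] by (simp add: map_le_def)
    next
      case False
      then have "s \<xi> = None" by blast
      with False show ?thesis
        using dom_bin_seqs[OF assms(1)] by simp
    qed
  qed
  have "dom s \<subseteq> dom t"
    using le by (rule map_le_implies_dom_le)
  then have "ht s \<le> ht t"
    using dom_bin_seqs assms by simp
  moreover have "t |` {..<ht t} = t"
  proof
    fix \<xi>
    show "(t |` {..<ht t}) \<xi> = t \<xi>"
    proof (cases "\<xi> \<in> dom t")
      case True
      then show ?thesis
        using dom_bin_seqs[OF assms(2)] by simp
    next
      case False
      then have "t \<xi> = None" by blast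
      with False show ?thesis
        using dom_bin_seqs[OF assms(2)] by simp
    qed
  qed
  ultimately show "ht s < ht t"
    using eq ne by (metis order_le_less)
qed

lemma mem_below_level: "x \<in> below_level S \<alpha> \<longleftrightarrow> x \<in> S \<and> ht x < \<alpha>"
  by (auto simp: below_level_def level_def)

lemma below_level_mono: "\<beta> \<le> \<alpha> \<Longrightarrow> below_level S \<beta> \<subseteq> below_level S \<alpha>"
  by (auto simp: mem_below_level)

text \<open>A level is an antichain, since proper extension raises the height.\<close>

lemma countable_level:
  assumes "suslin_tree S"
  shows "countable (level S \<alpha>)"
proof -
  have "\<not> tree_less s t" if "s \<in> level S \<alpha>" "t \<in> level S \<alpha>" for s t
    using that tree_less_bin_seqs(1)[of s t] assms by (auto simp: level_def suslin_tree_def)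
  then show ?thesis
    using assms by (simp add: suslin_tree_def antichain_in_def level_def subset_iff)
qed

lemma restrict_mem_level:
  assumes "suslin_tree S" "t \<in> level S \<alpha>" "\<beta> \<le> \<alpha>"
  shows "t |` {..<\<beta>} \<in> level S \<beta>"
  using assms ht_restrict[of t \<beta>] by (auto simp: level_def suslin_tree_def)

lemma diff_set_restrict:
  assumes "suslin_tree S" "u \<in> level S \<alpha>" "v \<in> level S \<alpha>" "\<beta> \<le> \<alpha>"
  shows "diff_set (u |` {..<\<beta>}) (v |` {..<\<beta>}) = diff_set u v \<inter> {..<\<beta>}"
  using assms restrict_mem_level[OF assms(1,2,4)] restrict_mem_level[OF assms(1,3,4)]
  by (auto simp: diff_set_def level_def)

text \<open>Values are bits, so at \<gamma> exactly one of \<open>u\<close> and \<open>v\<close>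
  differs from \<open>w\<close>; elsewhere \<open>u\<close> and \<open>v\<close> agree. The two
  difference sets therefore differ by the single element \<gamma>.\<close>

lemma odd_card_diff_set:
  assumes "u \<in> bin_seqs" "v \<in> bin_seqs" "w \<in> bin_seqs" "ht u = ht w" "ht v = ht w"
    and "finite (diff_set u w)" and "diff_set u v = {\<gamma>}"
  shows "odd (card (diff_set u w)) \<noteq> odd (card (diff_set v w))"
proof -
  have some: "\<exists>i. s \<xi> = Some i" if "s \<in> bin_seqs" "\<xi> < ht s" for s \<xi>
    using dom_bin_seqs[OF that(1)] that(2) by (simp add: dom_def set_eq_iff)
  have "\<gamma> \<in> diff_set u v" using assms(7) by simp
  then have \<gamma>: "\<gamma> < ht w" "u \<gamma> \<noteq> v \<gamma>"
    using assms by (auto simp: diff_set_def)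
  have flip: "\<gamma> \<in> diff_set u w \<longleftrightarrow> \<gamma> \<notin> diff_set v w"
    using \<gamma> some[OF assms(1), of \<gamma>] some[OF assms(2), of \<gamma>] some[OF assms(3), of \<gamma>] assms(4,5)
    by (auto simp: diff_set_def)
  have "u \<xi> = v \<xi>" if "\<xi> < ht w" "\<xi> \<noteq> \<gamma>" for \<xi>
  proof -
    have "\<xi> \<notin> diff_set u v" using assms(7) that by simp
    then show ?thesis using that assms(4,5) by (simp add: diff_set_def)
  qed
  then have same: "diff_set u w - {\<gamma>} = diff_set v w - {\<gamma>}"
    using assms(4,5) by (auto simp: diff_set_def)
  show ?thesis
  proof (cases "\<gamma> \<in> diff_set u w")
    case True
    then have "diff_set u w = insert \<gamma> (diff_set v w)" "\<gamma> \<notin> diff_set v w"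
      using same flip by auto
    then show ?thesis using assms(6) by simp
  next
    case False
    then have "diff_set v w = insert \<gamma> (diff_set u w)"
      using same flip by auto
    then show ?thesis using assms(6) False by simp
  qed
qed

section \<open>Members of the families: halves, straddling and closure\<close>

definition lower_half :: "node set \<Rightarrow> node set" where
  "lower_half b = ho_enum b ` {..<card b div 2}"

text \<open>Cutting at half the cardinality makes both halves depend on \<open>b\<close> alone. For
  \<open>b\<close> in \<open>XX S s n\<close> the cut is at \<open>n\<close>, which gives the two
  chains of the definition.\<close>

definition upper_half :: "node set \<Rightarrow> node set" where
  "upper_half b = ho_enum b ` {card b div 2..<card b}"

lemma halves_subset:
  assumes "finite b" "b \<subseteq> bin_seqs"
  shows "lower_half b \<subseteq> b" and "upper_half b \<subseteq> b"
  using ho_enum_mem[OF assms] by (auto simp: lower_half_def upper_half_def)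

lemma XX_D:
  assumes "b \<in> XX S s n" "n > 0" "S \<subseteq> bin_seqs"
  shows "finite b" "b \<subseteq> S" "card b = 2 * n" "b \<noteq> {}" "\<exists>x\<in>b. ht s < ht x"
proof -
  show b: "finite b" "b \<subseteq> S" "card b = 2 * n"
    using assms(1) by (auto simp: XX_def nsets_def)
  then show "b \<noteq> {}"
    using assms(2) by auto
  have mem: "ho_enum b 0 \<in> b"
    using b assms(2,3) by (intro ho_enum_mem) auto
  have "s(ht s \<mapsto> False) \<subseteq>\<^sub>m ho_enum b 0"
    using assms(1) by (simp add: XX_def tree_less_def)
  then have "ht s \<in> dom (ho_enum b 0)"
    using map_le_implies_dom_le by fastforce
  then have "ht s < ht (ho_enum b 0)"
    using mem b(2) assms(3) dom_bin_seqs[of "ho_enum b 0"] by auto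
  then show "\<exists>x\<in>b. ht s < ht x"
    using mem by blast
qed

text \<open>There is at most one such member, because of two of them neither can lie strictly below
  the other. The weak inequalities also catch members with a node of height exactly \<beta>, as the
  successor step requires.\<close>

lemma non_overlapping_straddle:
  assumes "non_overlapping A" "\<And>b. b \<in> A \<Longrightarrow> finite b"
  shows "finite {b \<in> A. \<exists>x\<in>b. \<exists>y\<in>b. ht x \<le> \<beta> \<and> \<beta> \<le> ht y}" (is "finite ?B")
proof -
  have less: False if "b \<in> ?B" "d \<in> ?B" "Max (ht ` b) < Min (ht ` d)" for b d
  proof -
    obtain x y where "y \<in> b" "\<beta> \<le> ht y" "x \<in> d" "ht x \<le> \<beta>"
      using \<open>b \<in> ?B\<close> \<open>d \<in> ?B\<close> by blast
    moreover have "ht y \<le> Max (ht ` b)" "Min (ht ` d) \<le> ht x"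
      using calculation that assms(2) by simp_all
    ultimately show False
      using that(3) by (meson leD le_less_trans order_trans)
  qed
  have "b = d" if "b \<in> ?B" "d \<in> ?B" for b d
    using less[OF that] less[OF that(2,1)] assms(1) that
    unfolding non_overlapping_def by blast
  then show ?thesis
    by (metis (no_types, lifting) finite.emptyI finite_insert finite_subset insertCI subsetI)
qed

text \<open>Inclusion is only a partial order, so the least closed set must be exhibited: it is the
  intersection of all closed sets, among them \<open>S\<close>. If \<open>b\<close> is not inside
  it, some closed set fails to contain \<open>b\<close>, hence is disjoint from \<open>b\<close>,
  and so is the intersection.\<close>

lemma cl_closed:
  assumes "a \<subseteq> S" "\<And>A b. A \<in> F' \<Longrightarrow> b \<in> A \<Longrightarrow> b \<subseteq> S"
  shows "a \<subseteq> cl S a F'" and "\<And>A b. A \<in> F' \<Longrightarrow> b \<in> A \<Longrightarrow> b \<inter> cl S a F' = {} \<or> b \<subseteq> cl S a F'"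
proof -
  define Q where "Q = (\<lambda>a'. a' \<subseteq> S \<and> a \<subseteq> a' \<and> (\<forall>A\<in>F'. \<forall>b\<in>A. b \<inter> a' = {} \<or> b \<subseteq> a'))"
  have "Q S"
    using assms unfolding Q_def by simp
  define M where "M = \<Inter>{a'. Q a'}"
  have M_le: "M \<subseteq> a'" if "Q a'" for a'
    unfolding M_def using that by (intro Inter_lower) simp
  have "Q M"
    unfolding Q_def
  proof (intro conjI ballI)
    show "M \<subseteq> S"
      using M_le[OF \<open>Q S\<close>] .
    show "a \<subseteq> M"
      unfolding M_def by (intro Inter_greatest) (simp add: Q_def)
    fix A b
    assume Ab: "A \<in> F'" "b \<in> A"
    show "b \<inter> M = {} \<or> b \<subseteq> M"
    proof (rule disjCI)
      assume "\<not> b \<subseteq> M"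
      then obtain a' where "Q a'" "\<not> b \<subseteq> a'"
        unfolding M_def by blast
      then have "b \<inter> a' = {}"
        using Ab unfolding Q_def by blast
      then show "b \<inter> M = {}"
        using M_le[OF \<open>Q a'\<close>] by blast
    qed
  qed
  then have "cl S a F' = M"
    using M_le unfolding cl_def Q_def by (intro Least_equality) simp_all
  with \<open>Q M\<close> show "a \<subseteq> cl S a F'"
    and "\<And>A b. A \<in> F' \<Longrightarrow> b \<in> A \<Longrightarrow> b \<inter> cl S a F' = {} \<or> b \<subseteq> cl S a F'"
    by (simp_all add: Q_def)
qed

text \<open>Running maxima of an enumeration of the countably many ordinals below \<alpha>.\<close>

lemma cofinal_sequence:
  fixes \<alpha> :: omega1
  assumes "\<beta>\<^sub>0 < \<alpha>"
  obtains a :: "nat \<Rightarrow> omega1"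
  where "\<And>k. a k < \<alpha>" "\<And>j k. j \<le> k \<Longrightarrow> a j \<le> a k" "\<And>\<beta>. \<beta> < \<alpha> \<Longrightarrow> \<exists>k. \<beta> \<le> a k"
proof -
  define e where "e = from_nat_into {..<\<alpha>}"
  have range: "range e = {..<\<alpha>}"
    unfolding e_def using assms countable_lessThan_omega1 by (intro range_from_nat_into) auto
  define a where "a k = Max (e ` {..k})" for k
  show thesis
  proof (rule that)
    show "a k < \<alpha>" for k
    proof -
      have "a k \<in> e ` {..k}" unfolding a_def by (intro Max_in) auto
      then show ?thesis using range by blast
    qed
    show "a j \<le> a k" if "j \<le> k" for j k
      unfolding a_def using that by (intro Max_mono) auto
    show "\<exists>k. \<beta> \<le> a k" if \<beta>: "\<beta> < \<alpha>" for \<beta>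
    proof -
      have "\<beta> \<in> range e" using range \<beta> by simp
      then obtain k where "\<beta> = e k" by blast
      then have "\<beta> \<le> a k" unfolding a_def by (intro Max_ge) auto
      then show ?thesis ..
    qed
  qed
qed

section \<open>The level-by-level construction\<close>

text \<open>The relation is symmetric in \<open>u\<close> and \<open>v\<close>, so the construction
  need not know which of them comes first in the height order.\<close>

definition flips_at_root :: "node set \<Rightarrow> node set set \<Rightarrow> node \<Rightarrow> node \<Rightarrow> bool" where
  "flips_at_root S A u v \<longleftrightarrow>
     (\<exists>s\<in>S. \<exists>n>0. A \<subseteq> XX S s n \<and> diff_set u v = {ht s})"

definition splits :: "(node \<Rightarrow> bool) \<Rightarrow> (node \<Rightarrow> bool) \<Rightarrow> node set \<Rightarrow> bool" where
  "splits p q b \<longleftrightarrow> opposite_on (lower_half b) (upper_half b) p q"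

text \<open>The value \<open>f \<alpha> t x\<close> is the color of \<open>{x, t}\<close> for \<open>t\<close> of height \<open>\<alpha>\<close> and \<open>x\<close> of smaller
  height, comparable to \<open>t\<close> or not; this way one need not track which \<open>b\<close> lie below \<open>a(1)\<close>.\<close>

definition coherent_level :: "node set \<Rightarrow> node set set set \<Rightarrow> (omega1 \<Rightarrow> node \<Rightarrow> node \<Rightarrow> bool) \<Rightarrow>
    omega1 \<Rightarrow> (node \<Rightarrow> node \<Rightarrow> bool) \<Rightarrow> bool" where
  "coherent_level S F f \<alpha> r \<longleftrightarrow>
     (\<forall>t\<in>level S \<alpha>. \<forall>\<beta><\<alpha>. finite {x \<in> below_level S \<beta>. r t x \<noteq> f \<beta> (t |` {..<\<beta>}) x}) \<and>
     (\<forall>A\<in>F. \<forall>u\<in>level S \<alpha>. \<forall>v\<in>level S \<alpha>. flips_at_root S A u v \<longrightarrow>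
        finite {b \<in> A \<inter> Fpow (below_level S \<alpha>). \<not> splits (r u) (r v) b})"

context
  fixes S :: "node set" and F :: "node set set set"
  assumes suslin: "suslin_tree S" and complete: "complete_coherent S"
    and thin: "thin_kurepa_family S F"
begin

lemma S_bin_seqs: "S \<subseteq> bin_seqs"
  using suslin by (simp add: suslin_tree_def)

lemma family_mem:
  assumes "A \<in> F" "b \<in> A"
  shows "finite b" "b \<subseteq> S" "b \<noteq> {}"
proof -
  obtain s n where "n > 0" "A \<in> subsets_omega1 (XX S s n)"
    using thin assms(1) unfolding thin_kurepa_family_def by blast
  then have "b \<in> XX S s n"
    using assms(2) by (auto simp: subsets_omega1_def)
  then show "finite b" "b \<subseteq> S" "b \<noteq> {}"
    using XX_D[OF _ \<open>n > 0\<close> S_bin_seqs] by auto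
qed

lemma family_straddle:
  assumes "A \<in> F"
  shows "finite {b \<in> A. \<exists>x\<in>b. \<exists>y\<in>b. ht x \<le> \<beta> \<and> \<beta> \<le> ht y}"
  using thin assms family_mem(1)[OF assms]
  by (intro non_overlapping_straddle) (auto simp: thin_kurepa_family_def)

lemma finite_closure:
  assumes "finite E" "E \<subseteq> S" "finite F'" "F' \<subseteq> F"
  shows "\<exists>E'. finite E' \<and> E \<subseteq> E' \<and> (\<forall>A\<in>F'. \<forall>b\<in>A. b \<inter> E' = {} \<or> b \<subseteq> E')"
proof (intro exI[of _ "cl S E F'"] conjI ballI)
  have "E \<in> Fpow S" "F' \<in> Fpow F"
    using assms by (auto simp: Fpow_def)
  then show "finite (cl S E F')"
    using thin by (simp add: thin_kurepa_family_def)
  have sub: "b \<subseteq> S" if "A \<in> F'" "b \<in> A" for A b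
    using family_mem(2)[of A b] assms(4) that by auto
  show "E \<subseteq> cl S E F'"
    using cl_closed(1)[of E S F'] assms(2) sub by blast
  show "b \<inter> cl S E F' = {} \<or> b \<subseteq> cl S E F'" if "A \<in> F'" "b \<in> A" for A b
    using cl_closed(2)[of E S F' A b] assms(2) sub that by blast
qed

text \<open>Coherence of level \<gamma> with level \<beta> is applied to the restriction of
  \<open>u\<close> to \<gamma>, which has the same restriction to \<beta> as
  \<open>u\<close>.\<close>

lemma coherent_below:
  assumes IH: "\<And>\<gamma>. \<gamma> < \<alpha> \<Longrightarrow> coherent_level S F f \<gamma> (f \<gamma>)"
    and u: "u \<in> level S \<alpha>" and "\<beta> \<le> \<gamma>" "\<gamma> < \<alpha>"
  shows "finite {x \<in> below_level S \<beta>. f \<beta> (u |` {..<\<beta>}) x \<noteq> f \<gamma> (u |` {..<\<gamma>}) x}"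
proof (cases "\<beta> = \<gamma>")
  case True
  then show ?thesis by simp
next
  case False
  have "(u |` {..<\<gamma>}) |` {..<\<beta>} = u |` {..<\<beta>}"
    using \<open>\<beta> \<le> \<gamma>\<close> by (simp add: Int_absorb1)
  moreover have "u |` {..<\<gamma>} \<in> level S \<gamma>"
    using restrict_mem_level[OF suslin u] \<open>\<gamma> < \<alpha>\<close> by simp
  moreover have "\<forall>t\<in>level S \<gamma>. \<forall>\<beta><\<gamma>. finite {x \<in> below_level S \<beta>. f \<gamma> t x \<noteq> f \<beta> (t |` {..<\<beta>}) x}"
    using IH[OF \<open>\<gamma> < \<alpha>\<close>] by (simp add: coherent_level_def)
  moreover have "\<beta> < \<gamma>"
    using False \<open>\<beta> \<le> \<gamma>\<close> by simp
  ultimately have "finite {x \<in> below_level S \<beta>. f \<gamma> (u |` {..<\<gamma>}) x \<noteq> f \<beta> (u |` {..<\<beta>}) x}"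
    by force
  moreover have "{x \<in> below_level S \<beta>. f \<beta> (u |` {..<\<beta>}) x \<noteq> f \<gamma> (u |` {..<\<gamma>}) x} =
      {x \<in> below_level S \<beta>. f \<gamma> (u |` {..<\<gamma>}) x \<noteq> f \<beta> (u |` {..<\<beta>}) x}"
    by blast
  ultimately show ?thesis by simp
qed

text \<open>If the root is lower than \<beta>, the restrictions still differ exactly at its height
  and level \<beta> applies. If not, every member of \<open>A\<close> has a node above the height of
  the root, so no member lies below \<beta>.\<close>

lemma splits_below:
  assumes IH: "\<And>\<gamma>. \<gamma> < \<alpha> \<Longrightarrow> coherent_level S F f \<gamma> (f \<gamma>)"
    and uv: "u \<in> level S \<alpha>" "v \<in> level S \<alpha>" and "\<beta> < \<alpha>" and "A \<in> F" and "flips_at_root S A u v"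
  shows "finite {b \<in> A \<inter> Fpow (below_level S \<beta>).
    \<not> splits (f \<beta> (u |` {..<\<beta>})) (f \<beta> (v |` {..<\<beta>})) b}"
proof -
  obtain s n where s: "s \<in> S" "n > 0" "A \<subseteq> XX S s n" "diff_set u v = {ht s}"
    using \<open>flips_at_root S A u v\<close> by (auto simp: flips_at_root_def)
  show ?thesis
  proof (cases "ht s < \<beta>")
    case True
    have "diff_set (u |` {..<\<beta>}) (v |` {..<\<beta>}) = {ht s}"
      using diff_set_restrict[OF suslin uv] \<open>\<beta> < \<alpha>\<close> s(4) True by auto
    then have "flips_at_root S A (u |` {..<\<beta>}) (v |` {..<\<beta>})"
      using s unfolding flips_at_root_def by blast
    moreover have "u |` {..<\<beta>} \<in> level S \<beta>" "v |` {..<\<beta>} \<in> level S \<beta>"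
      using restrict_mem_level[OF suslin] uv \<open>\<beta> < \<alpha>\<close> by simp_all
    ultimately show ?thesis
      using IH[OF \<open>\<beta> < \<alpha>\<close>] \<open>A \<in> F\<close> by (simp add: coherent_level_def)
  next
    case False
    have "b \<notin> Fpow (below_level S \<beta>)" if b: "b \<in> A" for b
    proof -
      obtain x where "x \<in> b" "ht s < ht x"
        using XX_D(5)[OF subsetD[OF s(3) b] s(2) S_bin_seqs] by blast
      then have "x \<notin> below_level S \<beta>"
        using False by (auto simp: mem_below_level dest: less_trans)
      with \<open>x \<in> b\<close> show ?thesis by (auto simp: Fpow_def)
    qed
    then have "A \<inter> Fpow (below_level S \<beta>) = {}"
      by auto
    then show ?thesis by simp
  qed
qed

lemma successor_level:
  assumes IH: "\<And>\<gamma>. \<gamma> < \<alpha> \<Longrightarrow> coherent_level S F f \<gamma> (f \<gamma>)"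
    and "\<beta> < \<alpha>" and max: "\<And>\<gamma>. \<gamma> < \<alpha> \<Longrightarrow> \<gamma> \<le> \<beta>"
  shows "coherent_level S F f \<alpha> (\<lambda>t. f \<beta> (t |` {..<\<beta>}))"
  unfolding coherent_level_def
proof (intro conjI ballI allI impI)
  show "finite {x \<in> below_level S \<gamma>. f \<beta> (t |` {..<\<beta>}) x \<noteq> f \<gamma> (t |` {..<\<gamma>}) x}"
    if "t \<in> level S \<alpha>" "\<gamma> < \<alpha>" for t \<gamma>
    using coherent_below[OF IH that(1) max[OF that(2)] \<open>\<beta> < \<alpha>\<close>] by (simp add: eq_commute)
next
  fix A u v
  assume A: "A \<in> F" and uv: "u \<in> level S \<alpha>" "v \<in> level S \<alpha>" and flip: "flips_at_root S A u v"
  let ?bad = "\<lambda>b. \<not> splits (f \<beta> (u |` {..<\<beta>})) (f \<beta> (v |` {..<\<beta>})) b"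
  \<comment> \<open>Heights below \<alpha> are at most \<beta>, so a member that does not lie below
    \<beta> has a node of height exactly \<beta>, and this node serves as both \<open>x\<close> and
    \<open>y\<close>.\<close>
  have "b \<in> Fpow (below_level S \<beta>) \<or> (\<exists>x\<in>b. \<exists>y\<in>b. ht x \<le> \<beta> \<and> \<beta> \<le> ht y)"
    if b: "b \<in> Fpow (below_level S \<alpha>)" for b
  proof (rule disjCI)
    assume no: "\<not> (\<exists>x\<in>b. \<exists>y\<in>b. ht x \<le> \<beta> \<and> \<beta> \<le> ht y)"
    have "x \<in> below_level S \<beta>" if "x \<in> b" for x
    proof -
      have "x \<in> S" "ht x \<le> \<beta>"
        using b that max by (auto simp: Fpow_def mem_below_level)
      then show ?thesis
        using no that by (auto simp: mem_below_level not_le)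
    qed
    then show "b \<in> Fpow (below_level S \<beta>)"
      using b by (auto simp: Fpow_def)
  qed
  then have "{b \<in> A \<inter> Fpow (below_level S \<alpha>). ?bad b} \<subseteq>
      {b \<in> A \<inter> Fpow (below_level S \<beta>). ?bad b} \<union>
      {b \<in> A. \<exists>x\<in>b. \<exists>y\<in>b. ht x \<le> \<beta> \<and> \<beta> \<le> ht y}"
    by auto
  moreover have "finite ({b \<in> A \<inter> Fpow (below_level S \<beta>). ?bad b} \<union>
      {b \<in> A. \<exists>x\<in>b. \<exists>y\<in>b. ht x \<le> \<beta> \<and> \<beta> \<le> ht y})"
    using splits_below[OF IH uv \<open>\<beta> < \<alpha>\<close> A flip] family_straddle[OF A] by simp
  ultimately show "finite {b \<in> A \<inter> Fpow (below_level S \<alpha>). ?bad b}"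
    by (rule finite_subset)
qed

lemma limit_level:
  assumes IH: "\<And>\<gamma>. \<gamma> < \<alpha> \<Longrightarrow> coherent_level S F f \<gamma> (f \<gamma>)"
    and "\<beta>\<^sub>0 < \<alpha>" and limit: "\<And>\<beta>. \<beta> < \<alpha> \<Longrightarrow> \<exists>\<gamma><\<alpha>. \<beta> < \<gamma>"
    and nonempty: "level S \<alpha> \<noteq> {}"
  shows "\<exists>r. coherent_level S F f \<alpha> r"
proof -
  obtain a :: "nat \<Rightarrow> omega1" where a: "\<And>k. a k < \<alpha>" and a_mono: "\<And>j k. j \<le> k \<Longrightarrow> a j \<le> a k"
    and cofinal: "\<And>\<beta>. \<beta> < \<alpha> \<Longrightarrow> \<exists>k. \<beta> \<le> a k"
    using cofinal_sequence[OF \<open>\<beta>\<^sub>0 < \<alpha>\<close>] by metis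
  define X where "X k = below_level S (a k)" for k
  have X_Union: "(\<Union>k. X k) = below_level S \<alpha>"
  proof
    show "(\<Union>k. X k) \<subseteq> below_level S \<alpha>"
      unfolding X_def using a by (intro UN_least below_level_mono less_imp_le)
    show "below_level S \<alpha> \<subseteq> (\<Union>k. X k)"
    proof
      fix x
      assume x: "x \<in> below_level S \<alpha>"
      \<comment> \<open>The sequence is cofinal only in the weak sense, so an ordinal strictly above
        the height of \<open>x\<close> is put in between; here \<alpha> must be a limit.\<close>
      then obtain \<gamma> where "\<gamma> < \<alpha>" "ht x < \<gamma>"
        using limit by (auto simp: mem_below_level)
      then obtain k where "ht x < a k"
        using cofinal[of \<gamma>] by (meson less_le_trans)
      then show "x \<in> (\<Union>k. X k)"
        using x by (auto simp: X_def mem_below_level)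
    qed
  qed
  define t where "t = from_nat_into (level S \<alpha>)"
  have range_t: "range t = level S \<alpha>"
    unfolding t_def using nonempty countable_level[OF suslin] by (rule range_from_nat_into)
  define C where "C = {A \<inter> Fpow (below_level S \<alpha>) |A. A \<in> F}"
  have "countable C"
    using thin unfolding C_def thin_kurepa_family_def by blast
  \<comment> \<open>The empty trace is added so that the enumerated set is nonempty even if there is
    no family.\<close>
  define T where "T = from_nat_into (insert {} C)"
  have range_T: "range T = insert {} C"
    unfolding T_def using \<open>countable C\<close> by (intro range_from_nat_into) auto
  have "\<forall>D\<in>C. \<exists>A. A \<in> F \<and> D = A \<inter> Fpow (below_level S \<alpha>)"
    by (auto simp: C_def)
  \<comment> \<open>One family is chosen for each trace. Finiteness of straddling and of closure is
    known for families and passes to their traces.\<close>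
  from bchoice[OF this] obtain fam
    where fam: "\<forall>D\<in>C. fam D \<in> F \<and> D = fam D \<inter> Fpow (below_level S \<alpha>)"
    by (rule exE)
  have T_fam: "fam (T l) \<in> F \<and> b \<in> fam (T l) \<and> T l \<in> C \<and> b \<in> Fpow (below_level S \<alpha>)"
    if "b \<in> T l" for b l
  proof -
    have "T l \<in> insert {} C" using range_T by blast
    then have "T l \<in> C" using that by auto
    then show ?thesis using fam that by auto
  qed
  have T_mem: "finite b" "b \<subseteq> S" "b \<noteq> {}" "b \<subseteq> below_level S \<alpha>" if "b \<in> T l" for b l
    using T_fam[OF that] family_mem[of "fam (T l)" b] by (auto simp: Fpow_def)
  define h where "h k u = f (a k) (u |` {..<a k})" for k u
  \<comment> \<open>Different families may share a trace, so \<open>A\<close> ranges over all of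
    them and need not be the chosen \<open>fam (T l)\<close>.\<close>
  define R where "R l u v \<longleftrightarrow> u \<in> level S \<alpha> \<and> v \<in> level S \<alpha> \<and>
    (\<exists>A\<in>F. T l = A \<inter> Fpow (below_level S \<alpha>) \<and> flips_at_root S A u v)" for l u v
  \<comment> \<open>The reference node is \<open>t 0\<close>; coherence makes the difference sets
    finite, so the parity is meaningful.\<close>
  define p where "p u = odd (card (diff_set u (t 0)))" for u
  obtain r where r_coh: "\<And>k u. u \<in> range t \<Longrightarrow> finite {x \<in> X k. r u x \<noteq> h k u x}"
    and r_hom: "\<And>l u v. R l u v \<Longrightarrow>
      finite {b \<in> T l. \<not> opposite_on (lower_half b) (upper_half b) (r u) (r v)}"
  proof (rule limit_coloring[of X t h T lower_half upper_half R p])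
    show "X j \<subseteq> X k" if "j \<le> k" for j k
      unfolding X_def using a_mono[OF that] by (rule below_level_mono)
    show "finite {x \<in> X j. h j u x \<noteq> h k u x}" if "j \<le> k" "u \<in> range t" for j k u
      unfolding X_def h_def using that range_t a_mono a by (intro coherent_below[OF IH]) auto
    show "finite b \<and> b \<noteq> {} \<and> b \<subseteq> (\<Union>k. X k)" if "b \<in> T l" for l b
      using T_mem[OF that] X_Union by simp
    show "finite {b \<in> T l. b \<inter> X k \<noteq> {} \<and> \<not> b \<subseteq> X k}" for l k
    proof (cases "T l = {}")
      case False
      then have "fam (T l) \<in> F" using T_fam by blast
      have straddles: "\<exists>x\<in>b. \<exists>y\<in>b. ht x \<le> a k \<and> a k \<le> ht y"
        if "b \<in> T l" "b \<inter> X k \<noteq> {}" "\<not> b \<subseteq> X k" for b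
      proof -
        obtain x y where "x \<in> b" "x \<in> X k" "y \<in> b" "y \<notin> X k"
          using \<open>b \<inter> X k \<noteq> {}\<close> \<open>\<not> b \<subseteq> X k\<close> by blast
        moreover have "y \<in> S"
          using T_mem(2)[OF \<open>b \<in> T l\<close>] \<open>y \<in> b\<close> by blast
        ultimately have "ht x \<le> a k" "a k \<le> ht y"
          by (auto simp: X_def mem_below_level)
        with \<open>x \<in> b\<close> \<open>y \<in> b\<close> show ?thesis
          by (intro bexI conjI)
      qed
      have "{b \<in> T l. b \<inter> X k \<noteq> {} \<and> \<not> b \<subseteq> X k} \<subseteq>
          {b \<in> fam (T l). \<exists>x\<in>b. \<exists>y\<in>b. ht x \<le> a k \<and> a k \<le> ht y}"
      proof (intro Collect_mono impI)
        fix b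
        assume b: "b \<in> T l \<and> b \<inter> X k \<noteq> {} \<and> \<not> b \<subseteq> X k"
        then show "b \<in> fam (T l) \<and> (\<exists>x\<in>b. \<exists>y\<in>b. ht x \<le> a k \<and> a k \<le> ht y)"
          using straddles[of b] T_fam[of b l] by simp
      qed
      then show ?thesis
        using family_straddle[OF \<open>fam (T l) \<in> F\<close>] by (rule finite_subset)
    qed simp
    show "\<exists>E'. finite E' \<and> E \<subseteq> E' \<and> (\<forall>l<m. \<forall>b\<in>T l. b \<inter> E' = {} \<or> b \<subseteq> E')"
      if E: "finite E" "E \<subseteq> (\<Union>k. X k)" for m E
    proof -
      have "E \<subseteq> S"
        using E(2) X_Union by (auto simp: mem_below_level)
      \<comment> \<open>Intersecting with \<open>C\<close> discards an artificially added empty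
        trace, for which \<open>fam\<close> is unspecified. A set closed under the chosen families
        is closed under their traces.\<close>
      moreover have "finite (fam ` (T ` {..<m} \<inter> C))" "fam ` (T ` {..<m} \<inter> C) \<subseteq> F"
        using fam by auto
      ultimately obtain E' where E': "finite E'" "E \<subseteq> E'"
        "\<forall>A\<in>fam ` (T ` {..<m} \<inter> C). \<forall>b\<in>A. b \<inter> E' = {} \<or> b \<subseteq> E'"
        using finite_closure[OF E(1)] by metis
      have "b \<inter> E' = {} \<or> b \<subseteq> E'" if "l < m" "b \<in> T l" for l b
      proof -
        have "fam (T l) \<in> fam ` (T ` {..<m} \<inter> C)"
          using T_fam[OF that(2)] that(1) by auto
        then show ?thesis
          using E'(3)[THEN bspec, THEN bspec] T_fam[OF that(2)] by blast
      qed
      then show ?thesis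
        using E'(1,2) by blast
    qed
    show "lower_half b \<subseteq> b \<and> upper_half b \<subseteq> b" if "b \<in> T l" for l b
      using halves_subset[of b] T_mem(1,2)[OF that] S_bin_seqs by auto
    show "u \<in> range t \<and> v \<in> range t \<and> p u \<noteq> p v" if Rl: "R l u v" for l u v
    proof -
      have uv: "u \<in> level S \<alpha>" "v \<in> level S \<alpha>"
        using Rl by (auto simp: R_def)
      obtain s where s: "diff_set u v = {ht s}"
        using Rl by (auto simp: R_def flips_at_root_def)
      have t0: "t 0 \<in> level S \<alpha>"
        using range_t by blast
      have "finite (diff_set u (t 0))"
        using complete uv t0 by (auto simp: complete_coherent_def coherent_def level_def)
      then have "p u \<noteq> p v"
        unfolding p_def using uv t0 S_bin_seqs s
        by (intro odd_card_diff_set[of u v "t 0" "ht s"]) (auto simp: level_def)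
      then show ?thesis
        using uv range_t by simp
    qed
    show "finite {b \<in> T l. b \<subseteq> X k \<and>
        \<not> opposite_on (lower_half b) (upper_half b) (h k u) (h k v)}" if Rl: "R l u v" for l u v k
    proof -
      obtain A where A: "u \<in> level S \<alpha>" "v \<in> level S \<alpha>" "A \<in> F"
        "T l = A \<inter> Fpow (below_level S \<alpha>)" "flips_at_root S A u v"
        using Rl by (auto simp: R_def)
      have "{b \<in> T l. b \<subseteq> X k \<and>
          \<not> opposite_on (lower_half b) (upper_half b) (h k u) (h k v)} \<subseteq>
        {b \<in> A \<inter> Fpow (below_level S (a k)).
          \<not> splits (f (a k) (u |` {..<a k})) (f (a k) (v |` {..<a k})) b}"
        using A(4) by (auto simp: splits_def h_def X_def Fpow_def)
      then show ?thesis
        using splits_below[OF IH A(1,2) a A(3,5)] by (rule finite_subset)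
    qed
  qed blast
  have "coherent_level S F f \<alpha> r"
    unfolding coherent_level_def
  proof (intro conjI ballI allI impI)
    fix w \<beta>
    assume w: "w \<in> level S \<alpha>" and "\<beta> < \<alpha>"
    then obtain k where k: "\<beta> \<le> a k"
      using cofinal by blast
    \<comment> \<open>Agreement with level \<beta> goes through a stage at or above \<beta>:
      \<open>r\<close> is close to stage \<open>k\<close>, and stage \<open>k\<close> is close to
      level \<beta>.\<close>
    have "{x \<in> below_level S \<beta>. r w x \<noteq> f \<beta> (w |` {..<\<beta>}) x} \<subseteq>
        {x \<in> X k. r w x \<noteq> h k w x} \<union>
        {x \<in> below_level S \<beta>. f \<beta> (w |` {..<\<beta>}) x \<noteq> f (a k) (w |` {..<a k}) x}"
      using below_level_mono[OF k] by (auto simp: X_def h_def)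
    moreover have "finite ({x \<in> X k. r w x \<noteq> h k w x} \<union>
        {x \<in> below_level S \<beta>. f \<beta> (w |` {..<\<beta>}) x \<noteq> f (a k) (w |` {..<a k}) x})"
      using r_coh[of w k] w range_t coherent_below[OF IH w k a] by simp
    ultimately show "finite {x \<in> below_level S \<beta>. r w x \<noteq> f \<beta> (w |` {..<\<beta>}) x}"
      by (rule finite_subset)
  next
    fix A u v
    assume A: "A \<in> F" "u \<in> level S \<alpha>" "v \<in> level S \<alpha>" "flips_at_root S A u v"
    then have "A \<inter> Fpow (below_level S \<alpha>) \<in> range T"
      unfolding range_T C_def by blast
    then obtain l where l: "T l = A \<inter> Fpow (below_level S \<alpha>)"
      by (metis rangeE)
    then have "R l u v"
      using A by (auto simp: R_def)
    from r_hom[OF this] show "finite {b \<in> A \<inter> Fpow (below_level S \<alpha>). \<not> splits (r u) (r v) b}"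
      unfolding l splits_def .
  qed
  then show ?thesis by blast
qed

text \<open>Cases: empty level, zero, successor, limit. The empty level is split off because the
  limit step enumerates the level by a sequence; at zero the only finite set of lower nodes is the
  empty one.\<close>

lemma coherent_level_exists:
  assumes IH: "\<And>\<gamma>. \<gamma> < \<alpha> \<Longrightarrow> coherent_level S F f \<gamma> (f \<gamma>)"
  shows "\<exists>r. coherent_level S F f \<alpha> r"
proof -
  consider "level S \<alpha> = {}" | "\<forall>\<gamma>. \<not> \<gamma> < \<alpha>"
    | \<beta> where "\<beta> < \<alpha>" "\<And>\<gamma>. \<gamma> < \<alpha> \<Longrightarrow> \<gamma> \<le> \<beta>"
    | \<beta>\<^sub>0 where "level S \<alpha> \<noteq> {}" "\<beta>\<^sub>0 < \<alpha>" "\<And>\<beta>. \<beta> < \<alpha> \<Longrightarrow> \<exists>\<gamma><\<alpha>. \<beta> < \<gamma>"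
    by (metis not_le)
  then show ?thesis
  proof cases
    case 1
    then show ?thesis by (simp add: coherent_level_def)
  next
    case 2
    then have "Fpow (below_level S \<alpha>) = {{}}"
      by (auto simp: Fpow_def mem_below_level)
    then have "finite {b \<in> A \<inter> Fpow (below_level S \<alpha>). P b}" for A P
      by simp
    then have "coherent_level S F f \<alpha> r" for r
      using 2 unfolding coherent_level_def by simp
    then show ?thesis by blast
  next
    case 3
    then show ?thesis
      using successor_level[OF IH] by blast
  next
    case 4
    then show ?thesis
      using limit_level[OF IH 4(2,3,1)] by blast
  qed
qed

text \<open>Transfinite recursion with a choice at each level; it applies because the condition at
  \<alpha> looks at \<open>f\<close> only below \<alpha>.\<close>

lemma coherent_coloring_exists:
  obtains f where "\<And>\<alpha>. coherent_level S F f \<alpha> (f \<alpha>)"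
proof -
  have "\<exists>f. \<forall>\<alpha>. coherent_level S F f \<alpha> (f \<alpha>)"
  proof (rule dependent_wellorder_choice)
    show "coherent_level S F f \<alpha> r = coherent_level S F g \<alpha> r"
      if "\<And>\<beta>. \<beta> < \<alpha> \<Longrightarrow> f \<beta> = g \<beta>" for r f g \<alpha>
      using that by (simp add: coherent_level_def)
  qed (rule coherent_level_exists)
  then show thesis
    using that by blast
qed

end

section \<open>Reading the coloring of pairs off the level functions\<close>

theorem theorem15:
  fixes S :: "node set" and F :: "node set set set"
  assumes "suslin_tree S" and "complete_coherent S" and "thin_kurepa_family S F"
  shows "\<exists>c \<in> nsets S 2 \<rightarrow> {..<2 :: nat}.
    (\<forall>s\<in>S. \<forall>t\<in>S. tree_less s t \<longrightarrow>
       finite {x \<in> S. tree_less x s \<and> c {x, s} \<noteq> c {x, t}}) \<and>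
    (\<forall>\<alpha>. \<forall>s\<in>below_level S \<alpha>. \<forall>n>0. \<forall>A \<in> F \<inter> subsets_omega1 (XX S s n).
       \<forall>a\<in>nsets (level S \<alpha>) 2. diff_set (ho_enum a 0) (ho_enum a 1) = {ht s} \<longrightarrow>
         finite {b \<in> A \<inter> Fpow (below_level S \<alpha>).
           \<not> (\<exists>i<2. tree_less (ho_enum b (2 * n - 1)) (ho_enum a 1) \<longrightarrow>
                (\<forall>j<n. c {ho_enum b j, ho_enum a 0} = i \<and>
                        c {ho_enum b (n + j), ho_enum a 1} = 1 - i))})"
proof -
  obtain f where f: "\<And>\<alpha>. coherent_level S F f \<alpha> (f \<alpha>)"
    using coherent_coloring_exists[OF assms] by blast
  have S: "S \<subseteq> bin_seqs"
    using assms(1) by (simp add: suslin_tree_def)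
  \<comment> \<open>The higher node of a pair decides which level function is consulted. Pairs of
    equal height get the default color 0.\<close>
  define c :: "node set \<Rightarrow> nat" where
    "c e = of_bool (\<exists>x y. e = {x, y} \<and> ht x < ht y \<and> f (ht y) y x)" for e
  have c: "c {x, y} = of_bool (f (ht y) y x)" if "ht x < ht y" for x y
  proof -
    have "(\<exists>x' y'. {x, y} = {x', y'} \<and> ht x' < ht y' \<and> f (ht y') y' x') = f (ht y) y x"
      using that by (auto simp: doubleton_eq_iff)
    then show ?thesis by (simp add: c_def)
  qed
  show ?thesis
  proof (intro bexI[of _ c] conjI allI ballI impI)
    show "c \<in> nsets S 2 \<rightarrow> {..<2}"
      by (auto simp: c_def)
  next
    fix s t
    assume st: "s \<in> S" "t \<in> S" "tree_less s t"
    then have lt: "ht s < ht t" and eq: "t |` {..<ht s} = s"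
      using tree_less_bin_seqs[of s t] S by auto
    \<comment> \<open>The two colors are read at the levels of \<open>s\<close> and of
      \<open>t\<close>. Since \<open>s\<close> is a restriction of \<open>t\<close>, this is
      coherence of the level of \<open>t\<close> with the lower level.\<close>
    have "{x \<in> S. tree_less x s \<and> c {x, s} \<noteq> c {x, t}} \<subseteq>
        {x \<in> below_level S (ht s). f (ht t) t x \<noteq> f (ht s) (t |` {..<ht s}) x}"
    proof clarify
      fix x
      assume x: "x \<in> S" "tree_less x s" "c {x, s} \<noteq> c {x, t}"
      then have "ht x < ht s"
        using tree_less_bin_seqs(1)[of x s] st(1) S by blast
      with x lt show "x \<in> below_level S (ht s) \<and> f (ht t) t x \<noteq> f (ht s) (t |` {..<ht s}) x"
        unfolding eq by (auto simp: mem_below_level c)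
    qed
    moreover have "finite {x \<in> below_level S (ht s). f (ht t) t x \<noteq> f (ht s) (t |` {..<ht s}) x}"
      using f[of "ht t"] lt st(2) by (simp add: coherent_level_def level_def)
    ultimately show "finite {x \<in> S. tree_less x s \<and> c {x, s} \<noteq> c {x, t}}"
      by (rule finite_subset)
  next
    fix \<alpha> s n A a
    assume s: "s \<in> below_level S \<alpha>" and n: "0 < n" and A: "A \<in> F \<inter> subsets_omega1 (XX S s n)"
      and a: "a \<in> nsets (level S \<alpha>) 2" and diff: "diff_set (ho_enum a 0) (ho_enum a 1) = {ht s}"
    define u v where "u = ho_enum a 0" and "v = ho_enum a 1"
    have "finite a" "card a = 2" "a \<subseteq> level S \<alpha>"
      using a by (auto simp: nsets_def)
    moreover have "a \<subseteq> bin_seqs"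
      using \<open>a \<subseteq> level S \<alpha>\<close> S by (auto simp: level_def)
    ultimately have uv: "u \<in> level S \<alpha>" "v \<in> level S \<alpha>"
      unfolding u_def v_def using ho_enum_mem[of a] by auto
    have AXX: "A \<subseteq> XX S s n"
      using A by (auto simp: subsets_omega1_def)
    then have "flips_at_root S A u v"
      using s n diff unfolding flips_at_root_def u_def v_def mem_below_level by blast
    then have fin: "finite {b \<in> A \<inter> Fpow (below_level S \<alpha>). \<not> splits (f \<alpha> u) (f \<alpha> v) b}"
      using f[of \<alpha>] A uv by (simp add: coherent_level_def)
    have "\<exists>i<2. \<forall>j<n. c {ho_enum b j, u} = i \<and> c {ho_enum b (n + j), v} = 1 - i"
      if b: "b \<in> A" "b \<in> Fpow (below_level S \<alpha>)" and split: "splits (f \<alpha> u) (f \<alpha> v) b" for b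
    proof -
      have bX: "finite b" "b \<subseteq> S" "card b = 2 * n"
        using XX_D[of b S s n] b(1) AXX n S by auto
      have ht: "ht (ho_enum b j) < \<alpha>" if "j < 2 * n" for j
      proof -
        have "ho_enum b j \<in> b"
          using ho_enum_mem[of b j] bX S that by auto
        then show ?thesis
          using b(2) by (auto simp: Fpow_def mem_below_level)
      qed
      obtain i where i: "\<And>x. x \<in> lower_half b \<Longrightarrow> f \<alpha> u x = i"
        "\<And>x. x \<in> upper_half b \<Longrightarrow> f \<alpha> v x = (\<not> i)"
        using split by (auto simp: splits_def opposite_on_def)
      have "c {ho_enum b j, u} = of_bool i \<and> c {ho_enum b (n + j), v} = 1 - of_bool i"
        if "j < n" for j
      proof
        have "ho_enum b j \<in> lower_half b" "ho_enum b (n + j) \<in> upper_half b"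
          using that bX(3) by (auto simp: lower_half_def upper_half_def)
        then have fi: "f \<alpha> u (ho_enum b j) = i" "f \<alpha> v (ho_enum b (n + j)) = (\<not> i)"
          using i by simp_all
        show "c {ho_enum b j, u} = of_bool i"
          using c[of "ho_enum b j" u] ht[of j] uv(1) fi(1) that by (simp add: level_def)
        show "c {ho_enum b (n + j), v} = 1 - of_bool i"
          using c[of "ho_enum b (n + j)" v] ht[of "n + j"] uv(2) fi(2) that
          by (simp add: level_def)
      qed
      then show ?thesis
        by (intro exI[of _ "of_bool i"]) simp
    qed
    then have "{b \<in> A \<inter> Fpow (below_level S \<alpha>).
        \<not> (\<exists>i<2. tree_less (ho_enum b (2 * n - 1)) v \<longrightarrow>
          (\<forall>j<n. c {ho_enum b j, u} = i \<and> c {ho_enum b (n + j), v} = 1 - i))} \<subseteq>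
      {b \<in> A \<inter> Fpow (below_level S \<alpha>). \<not> splits (f \<alpha> u) (f \<alpha> v) b}"
      by blast
    then show "finite {b \<in> A \<inter> Fpow (below_level S \<alpha>).
        \<not> (\<exists>i<2. tree_less (ho_enum b (2 * n - 1)) (ho_enum a 1) \<longrightarrow>
          (\<forall>j<n. c {ho_enum b j, ho_enum a 0} = i \<and> c {ho_enum b (n + j), ho_enum a 1} = 1 - i))}"
      unfolding u_def[symmetric] v_def[symmetric] using fin by (rule finite_subset)
  qed
qed

end
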